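(* Let $n_1,n_2\ge2$, $n=n_1+n_2$, and let $\mathbf{X}=(X_1,\dots,X_{n_1})$, $\mathbf{Y}=(Y_1,\dots,Y_{n_2})$ be random vectors such that $(\mathbf{X},\mathbf{Y})$ has joint density $g(\mathbf{x},\mathbf{y})$ on $\mathbb{R}^{n_1}\times\mathbb{R}^{n_2}$. Let $T=S_1^2/S_2^2$, where $S_1^2,S_2^2$ are the sample variances of $\mathbf{X}$ and $\mathbf{Y}$. Suppose that $g$ is continuous, that $$s_1(\mathbf{x})\,g(\mathbf{x},r\mathbf{I})>0\quad\text{for some }\mathbf{x}\in\mathbb{R}^{n_1},\ r\in\mathbb{R},$$ and that for some $\varepsilon>0$ $$\int_{\mathbb{R}^{n_1}}s_1(\mathbf{x})^{n_2-1}\int_{-\infty}^\infty\sup_{\|\boldsymbol\xi\|<\varepsilon,\ \boldsymbol\xi\in L^\perp}g(\mathbf{x},r\mathbf{I}+s_1(\mathbf{x})\boldsymbol\xi)\,dr\,d\mathbf{x}<\infty.$$ Then $$\frac{\mathbf{P}(T>u)}{F_{n_1-1,n_2-1}(u)}=K_g+o(1)\quad\text{as }u\to\infty,$$ where $$K_g=\frac{\Gamma\left(\frac{n_1-1}{2}\right)(\pi(n_1-1))^{(n_2-1)/2}}{\Gamma\left(\frac{n-2}{2}\right)}\int_{\mathbb{R}^{n_1}}s_1(\mathbf{x})^{n_2-1}\int_{-\infty}^{\infty}g(\mathbf{x},r\mathbf{I})\,dr\,d\mathbf{x}$$ and $0<K_g<\infty$.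
   Context: Sample variances use divisors $n_1-1$ and $n_2-1$. $s_1(\mathbf{x})$ is the sample standard deviation of $\mathbf{x}\in\mathbb{R}^{n_1}$ (square root of the sample variance). $\mathbf{I}=(1/\sqrt{n_2},\dots,1/\sqrt{n_2})\in\mathbb{R}^{n_2}$; $L$ is the linear span of $\mathbf{I}$ in $\mathbb{R}^{n_2}$ and $L^\perp$ its orthogonal complement in $\mathbb{R}^{n_2}$. $F_{m,k}(u)=\mathbf{P}(\phi>u)$ is the tail of the $F$-distribution with $m$ (numerator) and $k$ (denominator) degrees of freedom. *)

theory Defs
  imports "HOL-Probability.Probability" "HOL-Library.Landau_Symbols"
begin

definition sample_mean :: "real ^ 'n \<Rightarrow> real" where
  "sample_mean x = (\<Sum>i\<in>UNIV. x $ i) / real CARD('n)"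

definition sample_var :: "real ^ 'n \<Rightarrow> real" where
  "sample_var x = (\<Sum>i\<in>UNIV. (x $ i - sample_mean x)\<^sup>2) / (real CARD('n) - 1)"

definition sample_sd :: "real ^ 'n \<Rightarrow> real" where
  "sample_sd x = sqrt (sample_var x)"

text \<open>
  If the second sample variance vanishes, HOL's convention \<open>x / 0 = 0\<close> gives the value 0.
  For samples with a joint density (and size at least 2) this is a null event.
\<close>

definition variance_ratio :: "real ^ 'm \<Rightarrow> real ^ 'n \<Rightarrow> real" where
  "variance_ratio x y = sample_var x / sample_var y"

definition unit_diag :: "real ^ 'n" where
  "unit_diag = (\<chi> i. 1 / sqrt (real CARD('n)))"

definition diag_line :: "(real ^ 'n) set" where
  "diag_line = span {unit_diag}"

text \<open>The \<open>F\<close>-distribution with \<open>m\<close> numerator and \<open>k\<close> denominator degrees of freedom.\<close>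

definition F_density :: "nat \<Rightarrow> nat \<Rightarrow> real \<Rightarrow> real" where
  "F_density m k x =
     (if x > 0 then
        (real m / real k) powr (real m / 2) * x powr (real m / 2 - 1)
          * (1 + real m / real k * x) powr (- ((real m + real k) / 2))
          / Beta (real m / 2) (real k / 2)
      else 0)"

definition F_distribution :: "nat \<Rightarrow> nat \<Rightarrow> real measure" where
  "F_distribution m k = density lborel (\<lambda>x. ennreal (F_density m k x))"

definition F_tail :: "nat \<Rightarrow> nat \<Rightarrow> real \<Rightarrow> real" where
  "F_tail m k u = measure (F_distribution m k) {u<..}"

text \<open>
  The constant \<open>K\<^sub>g\<close> is extended-nonnegative valued, so that its finiteness is
  a genuine claim; all integrals are integrals of nonnegative functions.
\<close>

definition K_const :: "((real ^ 'm) \<times> (real ^ 'n) \<Rightarrow> real) \<Rightarrow> ennreal" where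
  "K_const g =
     ennreal (Gamma ((real CARD('m) - 1) / 2)
        * (pi * (real CARD('m) - 1)) powr ((real CARD('n) - 1) / 2)
        / Gamma ((real CARD('m) + real CARD('n) - 2) / 2))
     * (\<integral>\<^sup>+ x. ennreal (sample_sd x ^ (CARD('n) - 1))
          * (\<integral>\<^sup>+ r. ennreal (g (x, r *\<^sub>R unit_diag)) \<partial>lborel) \<partial>lborel)"

end

theory Submission
  imports Defs
begin

text \<open>
  Since \<open>(CARD('n) - 1) * sample_var y\<close> is the squared distance of \<open>y\<close> from the diagonal line,
  \<open>T > u\<close> says that \<open>Y\<close> lies in the punctured tube of radius \<open>\<delta> * sample_sd X\<close> around that line,
  where \<open>\<delta> = sqrt ((CARD('n) - 1) / u)\<close>. Rotating the line onto a coordinate axis and scaling the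
  orthogonal directions by the radius pulls out the factor \<open>(\<delta> * sample_sd X) ^ (CARD('n) - 1)\<close> and
  leaves an integral over a fixed unit cylinder. As \<open>\<delta>\<close> tends to 0, continuity of \<open>g\<close> and the integrable
  supremum give its limit by dominated convergence: the volume of the unit ball of dimension
  \<open>CARD('n) - 1\<close> times the double integral in \<open>K_const\<close>. The \<open>F\<close> tail is asymptotic to a multiple
  of the same power \<open>u powr (- (CARD('n) - 1) / 2)\<close>.
\<close>

section \<open>Lebesgue integrals around a line through the origin\<close>

text \<open>This is the component of \<open>z\<close> orthogonal to \<open>e\<close> only for a unit
  vector \<open>e\<close>; basis vectors, their images under orthogonal maps and
  \<open>unit_diag\<close> all have norm 1.\<close>

abbreviation perp :: "'a::real_inner \<Rightarrow> 'a \<Rightarrow> 'a" where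
  "perp e z \<equiv> z - (z \<bullet> e) *\<^sub>R e"

text \<open>
  \<open>measure_orthogonal_image\<close> requires a well-ordered index type. Instead, the measure
  of \<open>{(x, y). x \<in> U \<and> x + f y \<in> B}\<close>, with \<open>U\<close> the unit ball,
  is computed in both orders of integration; orthogonality enters only through \<open>f -` U = U\<close>.
\<close>

lemma distr_lborel_orthogonal:
  fixes f :: "'a::euclidean_space \<Rightarrow> 'a"
  assumes f: "orthogonal_transformation f"
  shows "distr lborel borel f = lborel"
proof (rule measure_eqI)
  show "sets (distr lborel borel f) = sets (lborel :: 'a measure)" by simp
next
  fix B :: "'a set" assume "B \<in> sets (distr lborel borel f)"
  then have B[measurable]: "B \<in> sets borel" by simp
  have lin: "linear f" using f by (rule orthogonal_transformation_linear)
  have [measurable]: "f \<in> borel_measurable borel"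
    using lin by (intro borel_measurable_continuous_onI linear_continuous_on linear_conv_bounded_linear[THEN iffD1])
  have nf: "norm (f y) = norm y" for y using f by (rule orthogonal_transformation_norm)
  have shift: "(\<integral>\<^sup>+y. h (c + y) \<partial>lborel) = (\<integral>\<^sup>+y. h y \<partial>lborel)"
    if [measurable]: "h \<in> borel_measurable borel" for h :: "'a \<Rightarrow> ennreal" and c
    by (subst (2) lborel_distr_plus[symmetric, of c]) (simp add: nn_integral_distr)
  define U where "U = ball (0::'a) 1"
  have [measurable]: "U \<in> sets borel" by (simp add: U_def)
  have surj: "\<exists>c. f c = x" for x
    using orthogonal_transformation_surj[OF f] by (metis surjD)
  have image_f: "emeasure (distr lborel borel f) B = (\<integral>\<^sup>+y. indicator B (f y) \<partial>lborel)"
    by (subst nn_integral_indicator[symmetric]) (simp_all add: nn_integral_distr del: nn_integral_indicator)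
  have "emeasure lborel U * emeasure (distr lborel borel f) B
      = (\<integral>\<^sup>+x. \<integral>\<^sup>+y. indicator U x * indicator B (f y) \<partial>lborel \<partial>lborel)"
    by (simp add: image_f nn_integral_cmult nn_integral_multc)
  also have "\<dots> = (\<integral>\<^sup>+x. \<integral>\<^sup>+y. indicator U x * indicator B (x + f y) \<partial>lborel \<partial>lborel)"
  proof (rule nn_integral_cong)
    fix x :: 'a
    \<comment> \<open>A preimage \<open>c\<close> of \<open>x\<close> turns the translation of
      \<open>y\<close> by \<open>c\<close> into the translation of \<open>f y\<close> by
      \<open>x\<close>.\<close>
    obtain c where "f c = x" using surj by blast
    then show "(\<integral>\<^sup>+y. indicator U x * indicator B (f y) \<partial>lborel)
      = (\<integral>\<^sup>+y. indicator U x * indicator B (x + f y) \<partial>lborel)"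
      using shift[of "\<lambda>y. indicator U x * indicator B (f y)" c] by (simp add: linear_add[OF lin])
  qed
  also have "\<dots> = (\<integral>\<^sup>+y. \<integral>\<^sup>+x. indicator U x * indicator B (x + f y) \<partial>lborel \<partial>lborel)"
    by (rule lborel_pair.Fubini'[symmetric]) measurable
  also have "\<dots> = (\<integral>\<^sup>+y. \<integral>\<^sup>+x. indicator U (x - f y) * indicator B x \<partial>lborel \<partial>lborel)"
  proof (rule nn_integral_cong)
    fix y :: 'a
    show "(\<integral>\<^sup>+x. indicator U x * indicator B (x + f y) \<partial>lborel)
      = (\<integral>\<^sup>+x. indicator U (x - f y) * indicator B x \<partial>lborel)"
      using shift[of "\<lambda>x. indicator U (x - f y) * indicator B x" "f y"] by (simp add: add.commute)
  qed
  also have "\<dots> = (\<integral>\<^sup>+x. \<integral>\<^sup>+y. indicator U (x - f y) * indicator B x \<partial>lborel \<partial>lborel)"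
    by (rule lborel_pair.Fubini'[symmetric]) measurable
  also have "\<dots> = (\<integral>\<^sup>+x. emeasure lborel U * indicator B x \<partial>lborel)"
  proof (rule nn_integral_cong)
    fix x :: 'a
    obtain c where c: "f c = x" using surj by blast
    \<comment> \<open>After translating by a preimage \<open>c\<close> of \<open>x\<close>, the
      argument \<open>x - f (c + y)\<close> is just \<open>- f y\<close>, which lies in the ball
      exactly when \<open>y\<close> does.\<close>
    have "(\<integral>\<^sup>+y. indicator U (x - f y) * indicator B x \<partial>lborel)
      = (\<integral>\<^sup>+y. indicator U (x - f (c + y)) * indicator B x \<partial>lborel)"
      using shift[of "\<lambda>y. indicator U (x - f y) * indicator B x" c] by simp
    also have "\<dots> = (\<integral>\<^sup>+y. indicator U y * indicator B x \<partial>lborel)"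
      by (intro nn_integral_cong) (simp add: linear_add[OF lin] c U_def nf indicator_def)
    finally show "(\<integral>\<^sup>+y. indicator U (x - f y) * indicator B x \<partial>lborel) = emeasure lborel U * indicator B x"
      by (simp add: nn_integral_multc)
  qed
  also have "\<dots> = emeasure lborel U * emeasure lborel B"
    by (simp add: nn_integral_cmult)
  finally have eq: "emeasure lborel U * emeasure (distr lborel borel f) B = emeasure lborel U * emeasure lborel B" .
  \<comment> \<open>The ball has positive finite measure, so it can be cancelled from both
    sides.\<close>
  have "emeasure lborel U \<noteq> 0" "emeasure lborel U < \<infinity>"
    using unit_ball_vol_pos[of "real DIM('a)"]
    unfolding U_def by (auto simp: emeasure_ball emeasure_lborel_ball_finite simp del: unit_ball_vol_pos)
  with eq show "emeasure (distr lborel borel f) B = emeasure lborel B"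
    by (auto simp: ennreal_mult_cancel_left)
qed

text \<open>The volume of closed balls is given by \<open>emeasure_cball_aux\<close>. The open unit
  ball lies inside the closed one and contains every closed ball of radius \<open>r < 1\<close>;
  letting \<open>r\<close> tend to 1 closes the gap.\<close>

lemma emeasure_PiM_ball:
  assumes "finite A"
  shows "emeasure (Pi\<^sub>M A (\<lambda>_. lborel)) ({w. sqrt (\<Sum>i\<in>A. (w i)\<^sup>2) < 1} \<inter> space (Pi\<^sub>M A (\<lambda>_. lborel)))
       = ennreal (unit_ball_vol (real (card A)))" (is "emeasure ?M ?U = ennreal ?v")
proof (rule antisym)
  have m: "{w. sqrt (\<Sum>i\<in>A. (w i)\<^sup>2) \<le> r} \<inter> space ?M \<in> sets ?M"
    "{w. sqrt (\<Sum>i\<in>A. (w i)\<^sup>2) < r} \<inter> space ?M \<in> sets ?M" for r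
    by measurable
  have "emeasure ?M ?U \<le> emeasure ?M ({w. sqrt (\<Sum>i\<in>A. (w i)\<^sup>2) \<le> 1} \<inter> space ?M)"
    using m by (intro emeasure_mono) auto
  then show "emeasure ?M ?U \<le> ennreal ?v"
    using emeasure_cball_aux[OF assms, of 1] by simp
  \<comment> \<open>Radii strictly between 0 and 1 that tend to 1. Starting the numerator at
    \<open>Suc n\<close> keeps the first radius positive, as the closed-ball formula
    requires.\<close>
  let ?r = "\<lambda>n. real (Suc n) / real (Suc (Suc n))"
  have "ennreal (?v * r ^ card A) \<le> emeasure ?M ?U" if "0 < r" "r < 1" for r
  proof -
    have "{w. sqrt (\<Sum>i\<in>A. (w i)\<^sup>2) \<le> r} \<inter> space ?M \<subseteq> ?U"
      using that by (auto simp del: real_sqrt_lt_1_iff)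
    then have "emeasure ?M ({w. sqrt (\<Sum>i\<in>A. (w i)\<^sup>2) \<le> r} \<inter> space ?M) \<le> emeasure ?M ?U"
      using m by (intro emeasure_mono)
    then show ?thesis using emeasure_cball_aux[OF assms \<open>0 < r\<close>] by simp
  qed
  then have "ennreal (?v * ?r n ^ card A) \<le> emeasure ?M ?U" for n
    by simp
  moreover have lim: "(\<lambda>n. ennreal (?v * ?r n ^ card A)) \<longlonglongrightarrow> ennreal (?v * 1 ^ card A)"
    using LIMSEQ_n_over_Suc_n[where 'a=real, THEN LIMSEQ_Suc]
    by (intro tendsto_intros)
  ultimately show "ennreal ?v \<le> emeasure ?M ?U"
    using LIMSEQ_le_const2[OF lim] unfolding power_one mult_1_right by blast
qed

text \<open>In coordinates the integrand is a product: \<open>\<phi>\<close> sees only the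
  coordinate along \<open>e\<close>, the indicator only the remaining ones. Fubini then gives the
  integral of \<open>\<phi>\<close> times the volume of the cross section, a unit ball of one
  dimension less.\<close>

lemma nn_integral_cylinder:
  fixes e :: "'a::euclidean_space" and \<phi> :: "real \<Rightarrow> ennreal"
  assumes e: "e \<in> Basis" and [measurable]: "\<phi> \<in> borel_measurable borel"
  shows "(\<integral>\<^sup>+z. \<phi> (z \<bullet> e) * indicator {z. norm (perp e z) < 1} z \<partial>lborel)
       = ennreal (unit_ball_vol (real (DIM('a) - 1))) * (\<integral>\<^sup>+r. \<phi> r \<partial>lborel)"
proof -
  interpret product_sigma_finite "\<lambda>_::'a. lborel :: real measure" by standard
  let ?B = "Basis - {e} :: 'a set"
  let ?S = "\<lambda>w. \<Sum>b\<in>Basis. w b *\<^sub>R b :: 'a"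
  let ?h = "\<lambda>z. \<phi> (z \<bullet> e) * indicator {z. norm (perp e z) < 1} z"
  have B: "Basis = insert e ?B" using e by auto
  have S: "?S w \<bullet> b = w b" if "b \<in> Basis" for w b
    using that by (simp add: inner_sum_left inner_Basis if_distrib cong: if_cong)
  \<comment> \<open>Expanding the squared norm in the basis: the \<open>e\<close>-coordinate of the
    orthogonal part is 0 and the others are those of \<open>w\<close>.\<close>
  have n: "norm (?S w - w e *\<^sub>R e) = sqrt (\<Sum>b\<in>?B. (w b)\<^sup>2)" for w
  proof -
    have "(norm (perp e (?S w)))\<^sup>2 = (\<Sum>b\<in>Basis. (perp e (?S w) \<bullet> b)\<^sup>2)"
      unfolding power2_norm_eq_inner by (subst euclidean_inner) (simp add: power2_eq_square)
    also have "\<dots> = (\<Sum>b\<in>Basis. (if b = e then 0 else w b)\<^sup>2)"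
      by (intro sum.cong refl) (use e in \<open>auto simp: S inner_diff_left inner_Basis\<close>)
    also have "\<dots> = (\<Sum>b\<in>?B. (w b)\<^sup>2)"
      by (subst B, subst sum.insert) (auto intro!: sum.cong)
    finally show ?thesis by (simp add: real_sqrt_unique S e)
  qed
  have upd: "(\<Sum>b\<in>?B. ((w(e := r)) b)\<^sup>2) = (\<Sum>b\<in>?B. (w b)\<^sup>2)" for w :: "'a \<Rightarrow> real" and r
    by (intro sum.cong) auto
  have hm[measurable]: "?h \<in> borel_measurable borel" by measurable
  have "(\<integral>\<^sup>+z. ?h z \<partial>lborel) = (\<integral>\<^sup>+w. ?h (?S w) \<partial>Pi\<^sub>M Basis (\<lambda>_. lborel))"
    by (subst lborel_eq) (simp add: nn_integral_distr)
  also have "\<dots> = (\<integral>\<^sup>+w. \<phi> (w e) * indicator {w. sqrt (\<Sum>b\<in>?B. (w b)\<^sup>2) < 1} w \<partial>Pi\<^sub>M (insert e ?B) (\<lambda>_. lborel))"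
    unfolding B[symmetric] by (intro nn_integral_cong) (simp add: S e n indicator_def)
  \<comment> \<open>The coordinate \<open>r\<close> along \<open>e\<close> becomes the outer
    variable; by \<open>upd\<close> it does not affect the indicator.\<close>
  also have "\<dots> = (\<integral>\<^sup>+r. \<integral>\<^sup>+w. \<phi> r * indicator ({w. sqrt (\<Sum>b\<in>?B. (w b)\<^sup>2) < 1} \<inter> space (Pi\<^sub>M ?B (\<lambda>_. lborel))) w
        \<partial>Pi\<^sub>M ?B (\<lambda>_. lborel) \<partial>lborel)"
    by (subst product_nn_integral_insert_rev)
       (auto intro!: nn_integral_cong simp: indicator_def upd fun_upd_same simp del: fun_upd_apply)
  also have "\<dots> = (\<integral>\<^sup>+r. \<phi> r * ennreal (unit_ball_vol (real (card ?B))) \<partial>lborel)"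
    by (intro nn_integral_cong) (simp add: nn_integral_cmult emeasure_PiM_ball[simplified])
  also have "\<dots> = ennreal (unit_ball_vol (real (DIM('a) - 1))) * (\<integral>\<^sup>+r. \<phi> r \<partial>lborel)"
    using e by (subst nn_integral_multc) (auto simp: mult.commute)
  finally show ?thesis .
qed

text \<open>The substitution is a diagonal linear map, with factor 1 on \<open>e\<close> and
  \<open>c\<close> on the other \<open>DIM('a) - 1\<close> basis vectors, so its Jacobian is
  \<open>c ^ (DIM('a) - 1)\<close>.\<close>

lemma nn_integral_scale_perp:
  fixes e :: "'a::euclidean_space" and h :: "'a \<Rightarrow> ennreal"
  assumes e: "e \<in> Basis" and c: "c > 0" and [measurable]: "h \<in> borel_measurable borel"
  shows "(\<integral>\<^sup>+z. h z \<partial>lborel)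
       = ennreal (c ^ (DIM('a) - 1)) * (\<integral>\<^sup>+z. h ((z \<bullet> e) *\<^sub>R e + c *\<^sub>R perp e z) \<partial>lborel)"
proof -
  let ?c = "\<lambda>j. if j = e then 1 else c"
  let ?T = "\<lambda>z. 0 + (\<Sum>j\<in>Basis. (?c j * (z \<bullet> j)) *\<^sub>R j)"
  have T: "?T z = (z \<bullet> e) *\<^sub>R e + c *\<^sub>R perp e z" for z
  proof (rule euclidean_eqI)
    fix b :: 'a assume b: "b \<in> Basis"
    then show "?T z \<bullet> b = ((z \<bullet> e) *\<^sub>R e + c *\<^sub>R perp e z) \<bullet> b"
      using e by (simp add: inner_sum_left inner_Basis if_distrib inner_add_left inner_diff_left cong: if_cong)
  qed
  have p: "(\<Prod>j\<in>Basis. \<bar>?c j\<bar>) = c ^ (DIM('a) - 1)"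
    using e c by (simp add: prod.remove[OF finite_Basis e] card_Diff_singleton)
  have "lborel = density (distr lborel borel ?T) (\<lambda>_. ennreal (\<Prod>j\<in>Basis. \<bar>?c j\<bar>))"
    by (rule lborel_affine_euclidean) (use c in auto)
  then have *: "lborel = density (distr lborel borel (\<lambda>z. (z \<bullet> e) *\<^sub>R e + c *\<^sub>R perp e z)) (\<lambda>_. ennreal (c ^ (DIM('a) - 1)))"
    unfolding T p .
  show ?thesis
    by (subst *) (simp add: nn_integral_density nn_integral_distr nn_integral_cmult)
qed

text \<open>Rotating by \<open>f\<close> moves the axis of the tube from \<open>f e\<close> to the
  coordinate axis \<open>e\<close>, and scaling the orthogonal directions by \<open>s\<close> makes
  the radius 1. The axis, which the left side omits, is a null set in dimension at least 2.\<close>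

lemma nn_integral_punctured_tube:
  fixes e :: "'a::euclidean_space" and h :: "'a \<Rightarrow> ennreal"
  assumes e: "e \<in> Basis" and f: "orthogonal_transformation f" and s: "s > 0" and dim: "DIM('a) \<ge> 2"
    and [measurable]: "h \<in> borel_measurable borel"
  shows "(\<integral>\<^sup>+y. h y * indicator {y. 0 < norm (perp (f e) y) \<and> norm (perp (f e) y) < s} y \<partial>lborel)
       = ennreal (s ^ (DIM('a) - 1)) *
         (\<integral>\<^sup>+z. h ((z \<bullet> e) *\<^sub>R f e + s *\<^sub>R f (perp e z)) * indicator {z. norm (perp e z) < 1} z \<partial>lborel)"
proof -
  have lin: "linear f" using f by (rule orthogonal_transformation_linear)
  have [measurable]: "f \<in> borel_measurable borel"
    using lin by (intro borel_measurable_continuous_onI linear_continuous_on linear_conv_bounded_linear[THEN iffD1])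
  have nf: "norm (perp (f e) (f z)) = norm (perp e z)" for z
  proof -
    have "perp (f e) (f z) = f (perp e z)"
      using f by (simp add: linear_diff[OF lin] linear_scale[OF lin] orthogonal_transformation_def)
    then show ?thesis using orthogonal_transformation_norm[OF f] by simp
  qed
  \<comment> \<open>A second basis vector \<open>b\<close> exists, and every point of the axis
    satisfies \<open>z \<bullet> b = 0\<close>; that hyperplane is null.\<close>
  have "card (Basis - {e}) \<noteq> 0" using e dim by (simp add: card_Diff_singleton)
  then obtain b where b: "b \<in> Basis" "b \<noteq> e"
    by (metis Diff_eq_empty_iff card.empty insertI1 subsetI singletonD)
  have nz: "AE z in lborel. 0 < norm (perp e z)"
    using AE_lborel_inner_neq[OF b(1), of 0]
  proof eventually_elim
    case (elim z)
    have "perp e z \<bullet> b = z \<bullet> b" using e b by (simp add: inner_diff_left inner_not_same_Basis)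
    then have "perp e z \<noteq> 0" using elim by (metis inner_zero_left)
    then show ?case by simp
  qed
  have "(\<integral>\<^sup>+y. h y * indicator {y. 0 < norm (perp (f e) y) \<and> norm (perp (f e) y) < s} y \<partial>lborel)
      = (\<integral>\<^sup>+z. h (f z) * indicator {z. 0 < norm (perp e z) \<and> norm (perp e z) < s} z \<partial>lborel)"
    by (subst distr_lborel_orthogonal[OF f, symmetric])
       (simp add: nn_integral_distr indicator_def nf del: zero_less_norm_iff)
  also have "\<dots> = (\<integral>\<^sup>+z. h (f z) * indicator {z. norm (perp e z) < s} z \<partial>lborel)"
    using nz by (intro nn_integral_cong_AE) (auto simp: indicator_def)
  also have "\<dots> = ennreal (s ^ (DIM('a) - 1)) *
      (\<integral>\<^sup>+z. h (f ((z \<bullet> e) *\<^sub>R e + s *\<^sub>R perp e z)) *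
        indicator {z. norm (perp e z) < s} ((z \<bullet> e) *\<^sub>R e + s *\<^sub>R perp e z) \<partial>lborel)"
    by (rule nn_integral_scale_perp[OF e s]) measurable
  also have "\<dots> = ennreal (s ^ (DIM('a) - 1)) *
      (\<integral>\<^sup>+z. h ((z \<bullet> e) *\<^sub>R f e + s *\<^sub>R f (perp e z)) * indicator {z. norm (perp e z) < 1} z \<partial>lborel)"
  proof -
    have "h (f ((z \<bullet> e) *\<^sub>R e + s *\<^sub>R perp e z)) *
        indicator {z. norm (perp e z) < s} ((z \<bullet> e) *\<^sub>R e + s *\<^sub>R perp e z)
      = h ((z \<bullet> e) *\<^sub>R f e + s *\<^sub>R f (perp e z)) * indicator {z. norm (perp e z) < 1} z" for z
    proof -
      have "perp e ((z \<bullet> e) *\<^sub>R e + s *\<^sub>R perp e z) = s *\<^sub>R perp e z"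
        using e by (simp add: inner_add_left inner_diff_left)
      then have "norm (perp e ((z \<bullet> e) *\<^sub>R e + s *\<^sub>R perp e z)) = s * norm (perp e z)"
        using s by (simp only: norm_scaleR)
      then have "norm (perp e ((z \<bullet> e) *\<^sub>R e + s *\<^sub>R perp e z)) < s \<longleftrightarrow> norm (perp e z) < 1"
        using s by simp
      moreover have "f ((z \<bullet> e) *\<^sub>R e + s *\<^sub>R perp e z) = (z \<bullet> e) *\<^sub>R f e + s *\<^sub>R f (perp e z)"
        by (simp only: linear_add[OF lin] linear_scale[OF lin])
      ultimately show ?thesis
        unfolding indicator_def mem_Collect_eq by simp
    qed
    then show ?thesis by (simp only:)
  qed
  finally show ?thesis .
qed

section \<open>Limit of the tube integral as the radius shrinks\<close>

text \<open>The index set may be uncountable, as for the supremum over \<xi>, so countable suprema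
  do not suffice. A supremum of continuous functions is lower semicontinuous, hence Borel.\<close>

lemma borel_measurable_SUP_continuous:
  fixes h :: "'i \<Rightarrow> 'a::topological_space \<Rightarrow> ennreal"
  assumes "\<And>i. i \<in> S \<Longrightarrow> continuous_on UNIV (h i)"
  shows "(\<lambda>p. SUP i\<in>S. h i p) \<in> borel_measurable borel"
proof (rule borel_measurableI_greater)
  fix y :: ennreal
  have "{p. y < (SUP i\<in>S. h i p)} = (\<Union>i\<in>S. {p. y < h i p})"
    by (auto simp: less_SUP_iff)
  moreover have "open {p. y < h i p}" if "i \<in> S" for i
    by (intro open_Collect_less continuous_on_const assms that)
  ultimately have "open {p. y < (SUP i\<in>S. h i p)}"
    by auto
  then show "{p \<in> space borel. y < (SUP i\<in>S. h i p)} \<in> sets borel"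
    by simp
qed

lemma nn_integral_lborel_pair:
  fixes W :: "'a::euclidean_space \<times> 'b::euclidean_space \<Rightarrow> ennreal"
  assumes "W \<in> borel_measurable borel"
  shows "(\<integral>\<^sup>+p. W p \<partial>lborel) = (\<integral>\<^sup>+x. \<integral>\<^sup>+z. W (x, z) \<partial>lborel \<partial>lborel)"
proof -
  have "W \<in> borel_measurable (lborel \<Otimes>\<^sub>M lborel)" using assms by (simp add: lborel_prod)
  from lborel.nn_integral_fst[OF this] show ?thesis by (simp add: lborel_prod)
qed

text \<open>Dominated convergence on the product space: for small \<delta> the point substituted
  into \<open>g\<close> is one of those over which the supremum in \<open>fin\<close> is taken. At
  \<delta> = 0 the integrand depends on \<open>z\<close> only through \<open>z \<bullet> e\<close>,
  and the cylinder integral supplies the ball volume.\<close>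

lemma tube_integral_tendsto:
  fixes g :: "'a::euclidean_space \<times> 'b::euclidean_space \<Rightarrow> real" and s :: "'a \<Rightarrow> real" and f :: "'b \<Rightarrow> 'b"
  assumes g: "continuous_on UNIV g"
    and s: "continuous_on UNIV s"
    and e: "e \<in> Basis" and f: "orthogonal_transformation f" and eps: "\<epsilon> > 0"
    and fin: "(\<integral>\<^sup>+x. ennreal (s x ^ k) * (\<integral>\<^sup>+r. (SUP \<xi>\<in>{\<xi>. norm \<xi> < \<epsilon> \<and> \<xi> \<in> (span {f e})\<^sup>\<bottom>}.
                ennreal (g (x, r *\<^sub>R f e + s x *\<^sub>R \<xi>))) \<partial>lborel) \<partial>lborel) < \<infinity>"
  shows "((\<lambda>\<delta>. \<integral>\<^sup>+x. ennreal (s x ^ k) * (\<integral>\<^sup>+z. ennreal (g (x, (z \<bullet> e) *\<^sub>R f e + (\<delta> * s x) *\<^sub>R f (perp e z))) *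
              indicator {z. norm (perp e z) < 1} z \<partial>lborel) \<partial>lborel)
     \<longlongrightarrow> ennreal (unit_ball_vol (real (DIM('b) - 1))) *
         (\<integral>\<^sup>+x. ennreal (s x ^ k) * (\<integral>\<^sup>+r. ennreal (g (x, r *\<^sub>R f e)) \<partial>lborel) \<partial>lborel)) (at_right 0)"
proof -
  define S where "S = {\<xi>. norm \<xi> < \<epsilon> \<and> \<xi> \<in> (span {f e})\<^sup>\<bottom>}"
  define D where "D = (\<lambda>p::'a \<times> real. SUP \<xi>\<in>S. ennreal (g (fst p, snd p *\<^sub>R f e + s (fst p) *\<^sub>R \<xi>)))"
  \<comment> \<open>\<open>W \<delta>\<close> is the whole integrand as one function of the pair,
    and \<open>V\<close> below is its majorant. A single limit theorem then covers both
    integrations.\<close>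
  define W where "W = (\<lambda>\<delta> (p::'a \<times> 'b). ennreal (s (fst p) ^ k) *
     (ennreal (g (fst p, (snd p \<bullet> e) *\<^sub>R f e + (\<delta> * s (fst p)) *\<^sub>R f (perp e (snd p)))) *
              indicator {z. norm (perp e z) < 1} (snd p)))"
  define V where "V = (\<lambda>(p::'a \<times> 'b). ennreal (s (fst p) ^ k) *
     (D (fst p, snd p \<bullet> e) * indicator {z. norm (perp e z) < 1} (snd p)))"
  let ?v = "ennreal (unit_ball_vol (real (DIM('b) - 1)))"
  have lin: "linear f" using f by (rule orthogonal_transformation_linear)
  have fc: "continuous_on T f" for T
    using lin by (intro linear_continuous_on linear_conv_bounded_linear[THEN iffD1])
  have sfst: "continuous_on T (\<lambda>p. s (fst p))" for T :: "('a \<times> 'c::topological_space) set"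
    by (rule continuous_on_compose2[OF s]) (auto intro: continuous_intros)
  have [measurable]: "s \<in> borel_measurable borel" using s by (rule borel_measurable_continuous_onI)
  have D[measurable]: "D \<in> borel_measurable borel"
    unfolding D_def
    by (intro borel_measurable_SUP_continuous continuous_on_ennreal continuous_on_compose2[OF g])
       (auto intro!: continuous_intros sfst)
  have [measurable]: "(\<lambda>p. g (fst p, (snd p \<bullet> e) *\<^sub>R f e + (\<delta> * s (fst p)) *\<^sub>R f (perp e (snd p))))
       \<in> borel_measurable borel" for \<delta>
    by (intro borel_measurable_continuous_onI continuous_on_compose2[OF g])
       (auto intro!: continuous_intros sfst continuous_on_compose2[OF fc])
  have [measurable]: "(\<lambda>p::'a \<times> 'b. fst p) \<in> borel \<rightarrow>\<^sub>M borel" "(\<lambda>p::'a \<times> 'b. snd p) \<in> borel \<rightarrow>\<^sub>M borel"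
    by (auto intro!: borel_measurable_continuous_onI continuous_intros)
  have [measurable]: "(\<lambda>p::'a \<times> 'b. D (fst p, snd p \<bullet> e)) \<in> borel_measurable borel"
    by (rule measurable_compose[OF _ D]) (auto intro!: borel_measurable_continuous_onI continuous_intros)
  have [measurable]: "W \<delta> \<in> borel_measurable borel" "V \<in> borel_measurable borel" for \<delta>
    unfolding W_def V_def by measurable
  have sec: "(\<lambda>z. g (x, (z \<bullet> e) *\<^sub>R f e + (\<delta> * s x) *\<^sub>R f (perp e z))) \<in> borel_measurable borel" for x \<delta>
    by (intro borel_measurable_continuous_onI continuous_on_compose2[OF g])
       (auto intro!: continuous_intros continuous_on_compose2[OF fc])
  have secr: "(\<lambda>r. ennreal (g (x, r *\<^sub>R f e))) \<in> borel_measurable borel" for x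
    by (intro measurable_compose[OF _ measurable_ennreal] borel_measurable_continuous_onI continuous_on_compose2[OF g])
       (auto intro!: continuous_intros)
  have secD: "(\<lambda>r. D (x, r)) \<in> borel_measurable borel" for x
    by (rule measurable_compose[OF _ D]) (auto intro!: borel_measurable_continuous_onI continuous_intros)
  have W: "(\<integral>\<^sup>+p. W \<delta> p \<partial>lborel) = (\<integral>\<^sup>+x. ennreal (s x ^ k) *
      (\<integral>\<^sup>+z. ennreal (g (x, (z \<bullet> e) *\<^sub>R f e + (\<delta> * s x) *\<^sub>R f (perp e z))) *
              indicator {z. norm (perp e z) < 1} z \<partial>lborel) \<partial>lborel)" for \<delta>
    using sec by (subst nn_integral_lborel_pair, simp, unfold W_def fst_conv snd_conv, subst nn_integral_cmult) auto
  have W0: "(\<integral>\<^sup>+p. W 0 p \<partial>lborel) = ?v * (\<integral>\<^sup>+x. ennreal (s x ^ k) * (\<integral>\<^sup>+r. ennreal (g (x, r *\<^sub>R f e)) \<partial>lborel) \<partial>lborel)"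
  proof -
    have meas: "(\<lambda>x. ennreal (s x ^ k) * (\<integral>\<^sup>+r. ennreal (g (x, r *\<^sub>R f e)) \<partial>lborel)) \<in> borel_measurable lborel"
    proof -
      have "(\<lambda>p::'a \<times> real. g (fst p, snd p *\<^sub>R f e)) \<in> borel_measurable borel"
        by (intro borel_measurable_continuous_onI continuous_on_compose2[OF g])
           (auto intro!: continuous_intros)
      then have "(\<lambda>p::'a \<times> real. ennreal (g (fst p, snd p *\<^sub>R f e))) \<in> borel_measurable (lborel \<Otimes>\<^sub>M lborel)"
        unfolding lborel_prod by simp
      from lborel.borel_measurable_nn_integral_fst[OF this] show ?thesis by simp
    qed
    have "(\<integral>\<^sup>+p. W 0 p \<partial>lborel) = (\<integral>\<^sup>+x. ?v * (ennreal (s x ^ k) * (\<integral>\<^sup>+r. ennreal (g (x, r *\<^sub>R f e)) \<partial>lborel)) \<partial>lborel)"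
      using nn_integral_cylinder[OF e secr] unfolding W by (simp add: mult_ac)
    then show ?thesis using meas by (simp add: nn_integral_cmult)
  qed
  \<comment> \<open>Integrating the majorant over the cylinder yields the ball volume times the
    integral assumed finite in \<open>fin\<close>.\<close>
  have V: "(\<integral>\<^sup>+p. V p \<partial>lborel) < \<infinity>"
  proof -
    have meas: "(\<lambda>x. ennreal (s x ^ k) * (\<integral>\<^sup>+r. D (x, r) \<partial>lborel)) \<in> borel_measurable lborel"
    proof -
      have "D \<in> borel_measurable (lborel \<Otimes>\<^sub>M lborel)" by (simp add: lborel_prod)
      from lborel.borel_measurable_nn_integral_fst[OF this] show ?thesis by simp
    qed
    have "(\<integral>\<^sup>+p. V p \<partial>lborel) = (\<integral>\<^sup>+x. ennreal (s x ^ k) *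
      (\<integral>\<^sup>+z. D (x, z \<bullet> e) * indicator {z. norm (perp e z) < 1} z \<partial>lborel) \<partial>lborel)"
    proof -
      have "(\<lambda>z. D (x, z \<bullet> e)) \<in> borel_measurable borel" for x
        by (rule measurable_compose[OF _ secD]) simp
      then show ?thesis
        by (subst nn_integral_lborel_pair, simp, unfold V_def fst_conv snd_conv, subst nn_integral_cmult) auto
    qed
    also have "\<dots> = (\<integral>\<^sup>+x. ?v * (ennreal (s x ^ k) * (\<integral>\<^sup>+r. D (x, r) \<partial>lborel)) \<partial>lborel)"
      using nn_integral_cylinder[OF e secD] by (simp add: mult_ac)
    also have "\<dots> = ?v * (\<integral>\<^sup>+x. ennreal (s x ^ k) * (\<integral>\<^sup>+r. D (x, r) \<partial>lborel) \<partial>lborel)"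
      using meas by (simp add: nn_integral_cmult)
    also have "\<dots> < \<infinity>"
      using fin by (simp add: D_def S_def ennreal_mult_less_top)
    finally show ?thesis .
  qed
  have bound: "W \<delta> p \<le> V p" if \<delta>: "0 < \<delta>" "\<delta> < \<epsilon>" for \<delta> p
  proof (cases "norm (perp e (snd p)) < 1")
    case True
    \<comment> \<open>The witness for the supremum: inside the unit cylinder its norm is at most
      \<delta>, hence below \<epsilon>, and it is orthogonal to \<open>f e\<close> because
      \<open>f\<close> preserves inner products.\<close>
    let ?\<xi> = "\<delta> *\<^sub>R f (perp e (snd p))"
    have "norm ?\<xi> = \<delta> * norm (perp e (snd p))" using \<delta> orthogonal_transformation_norm[OF f] by simp
    also have "\<dots> \<le> \<delta> * 1" using True \<delta> by (intro mult_left_mono) auto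
    finally have "norm ?\<xi> < \<epsilon>" using \<delta> by linarith
    moreover have "?\<xi> \<in> (span {f e})\<^sup>\<bottom>"
    proof -
      have "f e \<bullet> f (perp e (snd p)) = e \<bullet> perp e (snd p)" using f by (simp add: orthogonal_transformation_def)
      also have "\<dots> = 0" using e by (simp add: inner_diff_right inner_commute)
      finally show ?thesis
        by (auto simp: orthogonal_comp_def orthogonal_def span_singleton)
    qed
    ultimately have "?\<xi> \<in> S" by (simp add: S_def)
    then have "ennreal (g (fst p, (snd p \<bullet> e) *\<^sub>R f e + s (fst p) *\<^sub>R ?\<xi>)) \<le> D (fst p, snd p \<bullet> e)"
      unfolding D_def fst_conv snd_conv by (rule SUP_upper)
    then show ?thesis
      unfolding W_def V_def by (intro mult_left_mono mult_right_mono) (auto simp: mult.commute)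
  qed (simp add: W_def)
  have pointwise: "(\<lambda>i. W (d i) p) \<longlonglongrightarrow> W 0 p" if d: "d \<longlonglongrightarrow> 0" for d p
  proof (cases "norm (perp e (snd p)) < 1")
    case True
    have "(\<lambda>i. (fst p, (snd p \<bullet> e) *\<^sub>R f e + (d i * s (fst p)) *\<^sub>R f (perp e (snd p))))
      \<longlonglongrightarrow> (fst p, (snd p \<bullet> e) *\<^sub>R f e + (0 * s (fst p)) *\<^sub>R f (perp e (snd p)))"
      by (intro tendsto_intros d)
    from continuous_on_tendsto_compose[OF g this]
    have "(\<lambda>i. ennreal (g (fst p, (snd p \<bullet> e) *\<^sub>R f e + (d i * s (fst p)) *\<^sub>R f (perp e (snd p)))))
      \<longlonglongrightarrow> ennreal (g (fst p, (snd p \<bullet> e) *\<^sub>R f e + (0 * s (fst p)) *\<^sub>R f (perp e (snd p))))"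
      by (intro tendsto_ennrealI) auto
    then show ?thesis
      unfolding W_def using True
      by (intro ennreal_tendsto_cmult) (auto simp: indicator_def)
  qed (simp add: W_def)
  \<comment> \<open>The majorant is available only for \<delta> below \<epsilon>, so the limit is
    first taken within that interval; near 0 this is the filter \<open>at_right 0\<close>.\<close>
  have "((\<lambda>\<delta>. \<integral>\<^sup>+p. W \<delta> p \<partial>lborel) \<longlongrightarrow> (\<integral>\<^sup>+p. W 0 p \<partial>lborel)) (at 0 within {0<..<\<epsilon>})"
    unfolding tendsto_at_iff_sequentially comp_def
  proof (intro allI impI)
    fix d :: "nat \<Rightarrow> real" assume d: "\<forall>i. d i \<in> {0<..<\<epsilon>} - {0}" "d \<longlonglongrightarrow> 0"
    show "(\<lambda>i. \<integral>\<^sup>+p. W (d i) p \<partial>lborel) \<longlonglongrightarrow> (\<integral>\<^sup>+p. W 0 p \<partial>lborel)"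
      by (rule nn_integral_dominated_convergence[where w=V]) (use d bound pointwise V in auto)
  qed
  moreover have "at 0 within {0<..<\<epsilon>} = at_right 0"
    using eps by (intro at_within_nhd[of _ "{-\<epsilon><..<\<epsilon>}"]) auto
  ultimately show ?thesis
    unfolding W0 unfolding W by simp
qed

section \<open>Power-law tail of the F distribution\<close>

text \<open>For large \<open>x\<close> the factor \<open>1 + q * x\<close> behaves like
  \<open>q * x\<close>, so the density is asymptotic to a pure power. Bounding it on both sides by
  multiples of that power and integrating squeezes the tail.\<close>

lemma F_tail_asymp:
  assumes m: "m > 0" and k: "k > 0"
  shows "((\<lambda>u. u powr (real k / 2) * F_tail m k u) \<longlongrightarrow>
     (real m / real k) powr (- (real k / 2)) * (2 / real k) / Beta (real m / 2) (real k / 2)) at_top"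
proof -
  define a where "a = real m / 2"
  define b where "b = real k / 2"
  define q where "q = real m / real k"
  define C where "C = q powr (- b) / Beta a b"
  define G where "G = (\<lambda>u. \<integral>\<^sup>+x. ennreal (C * x powr (- b - 1)) * indicator {u..} x \<partial>lborel)"
  have pos: "a > 0" "b > 0" "q > 0" using m k by (auto simp: a_def b_def q_def)
  have Bpos: "Beta a b > 0" unfolding Beta_def using pos by (intro divide_pos_pos mult_pos_pos Gamma_real_pos) auto
  have Cpos: "C > 0" unfolding C_def using pos Bpos by simp
  have dens: "F_density m k x = q powr a * x powr (a - 1) * (1 + q * x) powr (- (a + b)) / Beta a b" if "x > 0" for x
    using that by (simp add: F_density_def a_def b_def q_def add_divide_distrib)
  \<comment> \<open>Replacing \<open>1 + q * x\<close> by \<open>q * x\<close> cancels the powers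
    with exponent \<open>a\<close>; this is where \<open>C\<close> comes from.\<close>
  have main: "q powr a * x powr (a - 1) * (q * x) powr (- (a + b)) / Beta a b = C * x powr (- b - 1)" if "x > 0" for x
    using that pos by (simp add: C_def powr_mult powr_minus powr_diff powr_add field_simps)
  have up: "F_density m k x \<le> C * x powr (- b - 1)" if "x > 0" for x
  proof -
    have "(1 + q * x) powr (- (a + b)) \<le> (q * x) powr (- (a + b))"
      using that pos by (intro powr_mono2') auto
    then show ?thesis unfolding dens[OF that] main[OF that, symmetric]
      using that pos Bpos by (intro divide_right_mono mult_left_mono) auto
  qed
  \<comment> \<open>On \<open>x \<ge> u\<close> one has \<open>1 \<le> q * x / (q * u)\<close>, so
    the replacement costs at most a factor depending on \<open>u\<close> alone, which tends to
    1.\<close>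
  have lo: "(1 + 1 / (q * u)) powr (- (a + b)) * (C * x powr (- b - 1)) \<le> F_density m k x" if "0 < u" "u \<le> x" for x u
  proof -
    have x: "x > 0" using that by simp
    have "1 + q * x \<le> (1 + 1 / (q * u)) * (q * x)"
      using that pos x by (simp add: field_simps)
    then have "((1 + 1 / (q * u)) * (q * x)) powr (- (a + b)) \<le> (1 + q * x) powr (- (a + b))"
      using x pos by (intro powr_mono2') (auto intro: add_pos_pos)
    then have "(1 + 1 / (q * u)) powr (- (a + b)) * (q * x) powr (- (a + b)) \<le> (1 + q * x) powr (- (a + b))"
      using x pos that by (simp add: powr_mult)
    then have "q powr a * x powr (a - 1) * ((1 + 1 / (q * u)) powr (- (a + b)) * (q * x) powr (- (a + b))) / Beta a b
       \<le> q powr a * x powr (a - 1) * (1 + q * x) powr (- (a + b)) / Beta a b"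
      using x pos Bpos by (intro divide_right_mono mult_left_mono) auto
    then show ?thesis unfolding dens[OF x] main[OF x, symmetric] by (simp add: mult_ac)
  qed
  have G: "G u = ennreal (C / b * u powr (- b))" if u: "u > 0" for u
  proof -
    have lim: "((\<lambda>x. - (C / b) * x powr (- b)) \<longlongrightarrow> - (C / b) * 0) at_top"
      using pos by (intro tendsto_intros tendsto_neg_powr filterlim_ident) auto
    have "G u = ennreal (- (C / b) * 0 - - (C / b) * u powr (- b))"
      unfolding G_def
    proof (rule nn_integral_FTC_atLeast[OF _ _ _ lim])
      fix x assume "u \<le> x"
      then have x: "x > 0" using u by simp
      show "((\<lambda>x. - (C / b) * x powr (- b)) has_real_derivative C * x powr (- b - 1)) (at x)"
        using x pos by (auto intro!: derivative_eq_intros)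
      show "0 \<le> C * x powr (- b - 1)" using Cpos by simp
    qed measurable
    then show ?thesis by simp
  qed
  \<comment> \<open>Passing to the closed half-line changes only a null set and matches the domain
    of integration in \<open>G\<close>.\<close>
  have tail: "emeasure (F_distribution m k) {u<..} = (\<integral>\<^sup>+x. ennreal (F_density m k x) * indicator {u..} x \<partial>lborel)" for u
  proof -
    have [measurable]: "F_density m k \<in> borel_measurable borel" unfolding F_density_def by measurable
    have "emeasure (F_distribution m k) {u<..} = (\<integral>\<^sup>+x. ennreal (F_density m k x) * indicator {u<..} x \<partial>lborel)"
      unfolding F_distribution_def by (subst emeasure_density) auto
    also have "\<dots> = (\<integral>\<^sup>+x. ennreal (F_density m k x) * indicator {u..} x \<partial>lborel)"
      using AE_lborel_singleton[of u] by (intro nn_integral_cong_AE) (auto simp: indicator_def)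
    finally show ?thesis .
  qed
  have ub: "F_tail m k u \<le> C / b * u powr (- b)" and lb: "(1 + 1 / (q * u)) powr (- (a + b)) * (C / b * u powr (- b)) \<le> F_tail m k u"
    if u: "u > 0" for u
  proof -
    have "emeasure (F_distribution m k) {u<..} \<le> G u"
      unfolding tail G_def using u up by (intro nn_integral_mono) (auto simp: indicator_def intro!: ennreal_leI)
    then have le: "emeasure (F_distribution m k) {u<..} \<le> ennreal (C / b * u powr (- b))" by (simp add: G u)
    then show "F_tail m k u \<le> C / b * u powr (- b)"
      unfolding F_tail_def measure_def using Cpos pos
      by (intro enn2real_leI) auto
    have "ennreal ((1 + 1 / (q * u)) powr (- (a + b))) * G u
       = (\<integral>\<^sup>+x. ennreal ((1 + 1 / (q * u)) powr (- (a + b))) * (ennreal (C * x powr (- b - 1)) * indicator {u..} x) \<partial>lborel)"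
      unfolding G_def by (subst nn_integral_cmult) auto
    also have "\<dots> \<le> emeasure (F_distribution m k) {u<..}"
      unfolding tail using u lo
      by (intro nn_integral_mono) (auto simp: indicator_def ennreal_mult'[symmetric] intro!: ennreal_leI)
    finally have "ennreal ((1 + 1 / (q * u)) powr (- (a + b)) * (C / b * u powr (- b))) \<le> emeasure (F_distribution m k) {u<..}"
      by (subst ennreal_mult') (simp_all add: G u)
    \<comment> \<open>\<open>measure\<close> returns 0 on sets of infinite measure, so the lower
      bound carries over to \<open>F_tail\<close> only after the upper bound \<open>le\<close> has
      shown finiteness.\<close>
    moreover have "emeasure (F_distribution m k) {u<..} = ennreal (F_tail m k u)"
      unfolding F_tail_def using le by (intro emeasure_eq_ennreal_measure) (auto simp: top_unique)
    ultimately show "(1 + 1 / (q * u)) powr (- (a + b)) * (C / b * u powr (- b)) \<le> F_tail m k u"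
      by (simp add: F_tail_def)
  qed
  have "((\<lambda>u. u powr b * F_tail m k u) \<longlongrightarrow> C / b) at_top"
  proof (rule tendsto_sandwich)
    show "\<forall>\<^sub>F u in at_top. (1 + 1 / (q * u)) powr (- (a + b)) * (C / b) \<le> u powr b * F_tail m k u"
      using eventually_gt_at_top[of 0]
    proof eventually_elim
      case (elim u)
      from mult_left_mono[OF lb[OF this], of "u powr b"] this show ?case
        by (simp add: powr_minus field_simps)
    qed
    show "\<forall>\<^sub>F u in at_top. u powr b * F_tail m k u \<le> C / b"
      using eventually_gt_at_top[of 0]
    proof eventually_elim
      case (elim u)
      from mult_left_mono[OF ub[OF this], of "u powr b"] this show ?case
        by (simp add: powr_minus field_simps)
    qed
    have "((\<lambda>u. 1 / (q * u)) \<longlongrightarrow> 0) at_top"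
      using pos by (intro tendsto_divide_0[OF tendsto_const] filterlim_at_top_imp_at_infinity
         filterlim_tendsto_pos_mult_at_top[OF tendsto_const] filterlim_ident)
    then have "((\<lambda>u. (1 + 1 / (q * u)) powr (- (a + b)) * (C / b)) \<longlongrightarrow> (1 + 0) powr (- (a + b)) * (C / b)) at_top"
      by (intro tendsto_intros) auto
    then show "((\<lambda>u. (1 + 1 / (q * u)) powr (- (a + b)) * (C / b)) \<longlongrightarrow> C / b) at_top" by simp
  qed auto
  then show ?thesis by (simp add: C_def a_def b_def q_def mult_ac)
qed

section \<open>Sample variance as distance from the diagonal\<close>

lemma norm_unit_diag: "norm (unit_diag :: real ^ 'n) = 1"
  by (simp add: norm_eq_sqrt_inner unit_diag_def inner_vec_def)

text \<open>The orthogonal projection of \<open>y\<close> onto the diagonal is the constant vector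
  with entries \<open>sample_mean y\<close>, so the deviations from the mean are the coordinates of
  the orthogonal part.\<close>

lemma sample_var_eq_norm_perp:
  fixes y :: "real ^ 'n"
  assumes "CARD('n) \<ge> 2"
  shows "sample_var y = (norm (perp unit_diag y))\<^sup>2 / real (CARD('n) - 1)"
proof -
  have "(y \<bullet> unit_diag) *\<^sub>R (unit_diag :: real ^ 'n) = (\<chi> i. sample_mean y)"
    by (simp add: vec_eq_iff sample_mean_def unit_diag_def inner_vec_def flip: sum_divide_distrib)
  then have "(norm (perp unit_diag y))\<^sup>2 = (\<Sum>i\<in>UNIV. (y $ i - sample_mean y)\<^sup>2)"
    by (simp only: power2_norm_eq_inner) (simp add: inner_vec_def power2_eq_square)
  then show ?thesis using assms by (simp add: sample_var_def of_nat_diff)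
qed

lemma continuous_on_sample_sd:
  assumes "CARD('n) \<ge> 2"
  shows "continuous_on A (sample_sd :: real ^ 'n \<Rightarrow> real)"
  unfolding sample_sd_def using assms by (simp add: sample_var_eq_norm_perp) (intro continuous_intros, simp)

lemma sample_sd_nonneg: "CARD('n) \<ge> 2 \<Longrightarrow> sample_sd (x :: real ^ 'n) \<ge> 0"
  by (simp add: sample_sd_def sample_var_eq_norm_perp)

text \<open>Clear the denominator and take square roots. The condition
  \<open>0 < norm (perp unit_diag y)\<close> reflects division by zero: on the diagonal the ratio is
  0, so it does not exceed \<open>u\<close>.\<close>

lemma variance_ratio_gt_iff:
  fixes x :: "real ^ 'm" and y :: "real ^ 'n"
  assumes n1: "CARD('m) \<ge> 2" and n2: "CARD('n) \<ge> 2" and u: "u > 0"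
  shows "variance_ratio x y > u \<longleftrightarrow> 0 < norm (perp unit_diag y) \<and>
      norm (perp unit_diag y) < sqrt (real (CARD('n) - 1) / u) * sample_sd x"
proof (cases "norm (perp unit_diag y) = 0")
  case True
  then show ?thesis using u by (simp add: variance_ratio_def sample_var_eq_norm_perp[OF n2])
next
  case False
  define N where "N = norm (perp unit_diag y)"
  have N: "N > 0" using False by (simp add: N_def)
  have k: "real (CARD('n) - 1) > 0" using n2 by simp
  have v: "sample_var x \<ge> 0" by (simp add: sample_var_eq_norm_perp[OF n1])
  have "variance_ratio x y > u \<longleftrightarrow> N\<^sup>2 < real (CARD('n) - 1) / u * sample_var x"
    using N k u by (simp add: variance_ratio_def sample_var_eq_norm_perp[OF n2] N_def[symmetric] field_simps)
  also have "\<dots> \<longleftrightarrow> N < sqrt (real (CARD('n) - 1) / u * sample_var x)"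
    using N by (simp add: real_less_rsqrt real_less_lsqrt) (metis abs_of_pos real_sqrt_abs real_sqrt_less_iff)
  also have "\<dots> \<longleftrightarrow> N < sqrt (real (CARD('n) - 1) / u) * sample_sd x"
    by (simp only: sample_sd_def real_sqrt_mult)
  finally show ?thesis using N by (simp add: N_def)
qed

section \<open>Tail asymptotics of the variance ratio\<close>

theorem theorem5p1:
  fixes M :: "'a measure"
    and X :: "'a \<Rightarrow> real ^ 'm"
    and Y :: "'a \<Rightarrow> real ^ 'n"
    and g :: "(real ^ 'm) \<times> (real ^ 'n) \<Rightarrow> real"
  assumes prob: "prob_space M"
    and n1: "CARD('m) \<ge> 2"
    and n2: "CARD('n) \<ge> 2"
    and g_nonneg: "\<And>z. g z \<ge> 0"
    and joint_density: "distributed M lborel (\<lambda>\<omega>. (X \<omega>, Y \<omega>)) (\<lambda>z. ennreal (g z))"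
    and g_cont: "continuous_on UNIV g"
    and g_pos: "\<exists>x r. sample_sd x * g (x, r *\<^sub>R unit_diag) > 0"
    and g_int: "\<exists>\<epsilon>>0.
       (\<integral>\<^sup>+ x. ennreal (sample_sd x ^ (CARD('n) - 1))
          * (\<integral>\<^sup>+ r. (SUP \<xi>\<in>{\<xi>. norm \<xi> < \<epsilon> \<and> \<xi> \<in> (diag_line :: (real ^ 'n) set)\<^sup>\<bottom>}.
                ennreal (g (x, r *\<^sub>R unit_diag + sample_sd x *\<^sub>R \<xi>))) \<partial>lborel) \<partial>lborel) < \<infinity>"
  shows "(\<lambda>u::real. measure M {\<omega> \<in> space M. variance_ratio (X \<omega>) (Y \<omega>) > u}
             / F_tail (CARD('m) - 1) (CARD('n) - 1) u - enn2real (K_const g)) \<in> o[at_top](\<lambda>_. 1)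
         \<and> 0 < K_const g \<and> K_const g < \<infinity>"
proof -
  interpret prob_space M by (rule prob)
  define k where "k = CARD('n) - 1"
  define m where "m = CARD('m) - 1"
  have k: "k > 0" and m: "m > 0" using n1 n2 by (auto simp: k_def m_def)
  have kr: "real CARD('n) - 1 = real k" "real CARD('m) - 1 = real m"
    "real CARD('m) + real CARD('n) - 2 = real m + real k"
    using n1 n2 by (auto simp: k_def m_def of_nat_diff)
  define s where "s = (sample_sd :: real ^ 'm \<Rightarrow> real)"
  define v where "v = (unit_diag :: real ^ 'n)"
  have s_cont: "continuous_on A s" for A unfolding s_def by (rule continuous_on_sample_sd[OF n1])
  have s0: "s x \<ge> 0" for x unfolding s_def by (rule sample_sd_nonneg[OF n1])
  \<comment> \<open>Any coordinate axis serves; some orthogonal map takes \<open>e\<close> to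
    \<open>v\<close> because both are unit vectors.\<close>
  obtain e :: "real ^ 'n" where e: "e \<in> Basis" using nonempty_Basis by blast
  obtain f where f: "orthogonal_transformation f" and fe: "f e = v"
    using orthogonal_transformation_exists_1[of e v] e norm_unit_diag unfolding v_def by auto
  have k_dim: "DIM(real ^ 'n) - 1 = k" by (simp add: k_def)
  from g_int obtain \<epsilon> where eps: "\<epsilon> > 0" and fin: "(\<integral>\<^sup>+ x. ennreal (s x ^ k)
          * (\<integral>\<^sup>+ r. (SUP \<xi>\<in>{\<xi>. norm \<xi> < \<epsilon> \<and> \<xi> \<in> (span {f e})\<^sup>\<bottom>}.
                ennreal (g (x, r *\<^sub>R f e + s x *\<^sub>R \<xi>))) \<partial>lborel) \<partial>lborel) < \<infinity>"
    unfolding s_def k_def v_def fe diag_line_def by blast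
  define J where "J = (\<integral>\<^sup>+ x. ennreal (s x ^ k) * (\<integral>\<^sup>+ r. ennreal (g (x, r *\<^sub>R v)) \<partial>lborel) \<partial>lborel)"
  define \<Phi> where "\<Phi> = (\<lambda>\<delta>. \<integral>\<^sup>+x. ennreal (s x ^ k) * (\<integral>\<^sup>+z. ennreal (g (x, (z \<bullet> e) *\<^sub>R v + (\<delta> * s x) *\<^sub>R f (perp e z))) *
              indicator {z. norm (perp e z) < 1} z \<partial>lborel) \<partial>lborel)"
  define P where "P = (\<lambda>u. measure M {\<omega> \<in> space M. variance_ratio (X \<omega>) (Y \<omega>) > u})"
  have \<Phi>: "(\<Phi> \<longlongrightarrow> ennreal (unit_ball_vol (real k)) * J) (at_right 0)"
    using tube_integral_tendsto[OF g_cont s_cont e f eps fin] unfolding fe k_dim \<Phi>_def J_def .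

  \<comment> \<open>Finiteness and positivity of the constant\<close>
  have J_fin: "J < \<infinity>"
  proof -
    have "J \<le> (\<integral>\<^sup>+ x. ennreal (s x ^ k) * (\<integral>\<^sup>+ r. (SUP \<xi>\<in>{\<xi>. norm \<xi> < \<epsilon> \<and> \<xi> \<in> (span {f e})\<^sup>\<bottom>}.
                ennreal (g (x, r *\<^sub>R f e + s x *\<^sub>R \<xi>))) \<partial>lborel) \<partial>lborel)"
      unfolding J_def
    proof (intro nn_integral_mono mult_left_mono)
      fix x r
      \<comment> \<open>The choice \<xi> = 0 is admissible in the supremum.\<close>
      show "ennreal (g (x, r *\<^sub>R v)) \<le> (SUP \<xi>\<in>{\<xi>. norm \<xi> < \<epsilon> \<and> \<xi> \<in> (span {f e})\<^sup>\<bottom>}.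
                ennreal (g (x, r *\<^sub>R f e + s x *\<^sub>R \<xi>)))"
        by (rule SUP_upper2[of 0]) (use eps in \<open>auto simp: fe orthogonal_comp_def orthogonal_def\<close>)
    qed auto
    then show ?thesis using fin by (rule le_less_trans)
  qed

  have gr_cont: "continuous_on UNIV (\<lambda>p. g (fst p, snd p *\<^sub>R v))"
    by (rule continuous_on_compose2[OF g_cont]) (auto intro!: continuous_intros)
  have J_pos: "J > 0"
  proof -
    \<comment> \<open>\<open>H\<close> is continuous, nonnegative and positive at the point from
      \<open>g_pos\<close>, hence positive on a nonempty open set, which has positive measure. So
      its integral, which is \<open>J\<close>, is not 0.\<close>
    define H where "H = (\<lambda>p. s (fst p) ^ k * g (fst p, snd p *\<^sub>R v))"
    have H_cont: "continuous_on UNIV H"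
      unfolding H_def by (intro continuous_intros gr_cont continuous_on_compose2[OF s_cont[of UNIV]]) auto
    have H0: "H p \<ge> 0" for p unfolding H_def using g_nonneg s0 by simp
    obtain x r where xr: "s x * g (x, r *\<^sub>R v) > 0" using g_pos unfolding s_def v_def by blast
    have "s x > 0" "g (x, r *\<^sub>R v) > 0" using xr s0[of x] g_nonneg[of "(x, r *\<^sub>R v)"]
      by (auto simp: zero_less_mult_iff)
    then have "(x, r) \<in> {p. H p > 0}" by (simp add: H_def)
    moreover have op: "open {p. H p > 0}" by (intro open_Collect_less continuous_on_const H_cont)
    ultimately have "\<not> negligible {p. H p > 0}" by (intro open_not_negligible) auto
    then have "{p. H p > 0} \<notin> null_sets lborel"
      by (metis negligible_iff_null_sets null_sets_completionI)
    then have ne: "emeasure lborel {p. H p > 0} \<noteq> 0"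
      using op by (auto simp: null_sets_def)
    have [measurable]: "H \<in> borel_measurable borel" using H_cont by (rule borel_measurable_continuous_onI)
    have gm: "(\<lambda>r. ennreal (g (x, r *\<^sub>R v))) \<in> borel_measurable borel" for x
      by (intro measurable_compose[OF _ measurable_ennreal] borel_measurable_continuous_onI continuous_on_compose2[OF g_cont])
         (auto intro!: continuous_intros)
    have "J = (\<integral>\<^sup>+x. \<integral>\<^sup>+r. ennreal (H (x, r)) \<partial>lborel \<partial>lborel)"
      unfolding J_def H_def using gm by (simp add: ennreal_mult' s0 nn_integral_cmult)
    also have "\<dots> = (\<integral>\<^sup>+p. ennreal (H p) \<partial>lborel)"
      by (rule nn_integral_lborel_pair[symmetric]) measurable
    also have "\<dots> \<noteq> 0"
    proof -
      have "{p \<in> space lborel. ennreal (H p) \<noteq> 0} = {p. H p > 0}"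
        using H0 by (fastforce simp: ennreal_eq_0_iff not_le)
      with ne show ?thesis by (subst nn_integral_0_iff) simp_all
    qed
    finally show ?thesis by (simp add: zero_less_iff_neq_zero)
  qed

  define c where "c = Gamma (real m / 2) * (pi * real m) powr (real k / 2) / Gamma ((real m + real k) / 2)"
  have c_pos: "c > 0" unfolding c_def using m k by (intro divide_pos_pos mult_pos_pos Gamma_real_pos) auto
  have K: "K_const g = ennreal c * J"
    unfolding K_const_def kr J_def c_def s_def v_def k_def ..
  have K_pos: "0 < K_const g" unfolding K using c_pos J_pos by (simp add: ennreal_zero_less_mult_iff)
  have K_fin: "K_const g < \<infinity>" unfolding K using J_fin by (simp add: ennreal_mult_less_top)

  \<comment> \<open>The tail probability as a tube integral\<close>
  have P_eq: "ennreal (P u) = ennreal (sqrt (real k / u) ^ k) * \<Phi> (sqrt (real k / u))" if u: "u > 0" for u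
  proof -
    define \<delta> where "\<delta> = sqrt (real k / u)"
    have \<delta>: "\<delta> > 0" using u k by (simp add: \<delta>_def)
    \<comment> \<open>The section of \<open>A\<close> at \<open>x\<close> is the punctured tube of
      radius \<open>\<delta> * s x\<close> around the diagonal.\<close>
    define A where "A = {p :: (real ^ 'm) \<times> (real ^ 'n). 0 < norm (perp v (snd p)) \<and> norm (perp v (snd p)) < \<delta> * s (fst p)}"
    have A_iff: "variance_ratio x y > u \<longleftrightarrow> (x, y) \<in> A" for x :: "real ^ 'm" and y :: "real ^ 'n"
      using variance_ratio_gt_iff[OF n1 n2 u] by (simp add: A_def \<delta>_def s_def v_def k_def)
    have "open A"
      unfolding A_def by (intro open_Collect_conj open_Collect_less continuous_intros continuous_on_compose2[OF s_cont[of UNIV]]) auto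
    then have A[measurable]: "A \<in> sets borel" by simp
    have [measurable]: "g \<in> borel_measurable borel" using g_cont by (rule borel_measurable_continuous_onI)
    have gx: "(\<lambda>y. ennreal (g (x, y))) \<in> borel_measurable borel" for x
      by (intro measurable_compose[OF _ measurable_ennreal] borel_measurable_continuous_onI continuous_on_compose2[OF g_cont])
         (auto intro!: continuous_intros)
    have dim: "DIM(real ^ 'n) \<ge> 2" using n2 by simp
    have "ennreal (P u) = emeasure M ((\<lambda>\<omega>. (X \<omega>, Y \<omega>)) -` A \<inter> space M)"
      unfolding P_def by (simp add: emeasure_eq_measure A_iff vimage_def Int_def conj_commute)
    also have "\<dots> = (\<integral>\<^sup>+p. ennreal (g p) * indicator A p \<partial>lborel)"
      by (rule distributed_emeasure[OF joint_density]) simp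
    also have "\<dots> = (\<integral>\<^sup>+x. \<integral>\<^sup>+y. ennreal (g (x, y)) * indicator A (x, y) \<partial>lborel \<partial>lborel)"
      by (rule nn_integral_lborel_pair) measurable
    also have "\<dots> = (\<integral>\<^sup>+x. ennreal (\<delta> ^ k) * (ennreal (s x ^ k) *
        (\<integral>\<^sup>+z. ennreal (g (x, (z \<bullet> e) *\<^sub>R v + (\<delta> * s x) *\<^sub>R f (perp e z))) *
              indicator {z. norm (perp e z) < 1} z \<partial>lborel)) \<partial>lborel)"
    proof (rule nn_integral_cong)
      fix x :: "real ^ 'm"
      show "(\<integral>\<^sup>+y. ennreal (g (x, y)) * indicator A (x, y) \<partial>lborel) = ennreal (\<delta> ^ k) * (ennreal (s x ^ k) *
        (\<integral>\<^sup>+z. ennreal (g (x, (z \<bullet> e) *\<^sub>R v + (\<delta> * s x) *\<^sub>R f (perp e z))) *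
              indicator {z. norm (perp e z) < 1} z \<partial>lborel))"
      \<comment> \<open>For \<open>s x = 0\<close> the tube is empty, and the right side vanishes as
        well because \<open>k > 0\<close> makes \<open>s x ^ k\<close> zero. Otherwise the radius is
        positive and the tube formula applies.\<close>
      proof (cases "s x = 0")
        case True
        then show ?thesis using k by (simp add: A_def)
      next
        case False
        then have pos: "\<delta> * s x > 0" using \<delta> s0[of x] by simp
        have "(\<integral>\<^sup>+y. ennreal (g (x, y)) * indicator A (x, y) \<partial>lborel) =
           (\<integral>\<^sup>+y. ennreal (g (x, y)) * indicator {y. 0 < norm (perp (f e) y) \<and> norm (perp (f e) y) < \<delta> * s x} y \<partial>lborel)"
          by (simp add: A_def indicator_def fe)
        also have "\<dots> = ennreal ((\<delta> * s x) ^ k) *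
           (\<integral>\<^sup>+z. ennreal (g (x, (z \<bullet> e) *\<^sub>R v + (\<delta> * s x) *\<^sub>R f (perp e z))) *
              indicator {z. norm (perp e z) < 1} z \<partial>lborel)"
          using nn_integral_punctured_tube[OF e f pos dim gx] unfolding fe k_dim .
        finally show ?thesis
          using \<delta> s0[of x] by (simp add: power_mult_distrib ennreal_mult mult_ac)
      qed
    qed
    also have "\<dots> = ennreal (\<delta> ^ k) * \<Phi> \<delta>"
      unfolding \<Phi>_def
    \<comment> \<open>Pulling the constant out requires measurability in \<open>x\<close> of the
      inner integral, obtained from joint measurability of its integrand.\<close>
    proof (rule nn_integral_cmult)
      have [measurable]: "s \<in> borel_measurable borel" using s_cont by (rule borel_measurable_continuous_onI)
      have fc: "continuous_on T f" for T
        using orthogonal_transformation_linear[OF f]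
        by (intro linear_continuous_on linear_conv_bounded_linear[THEN iffD1])
      have [measurable]: "(\<lambda>p. g (fst p, (snd p \<bullet> e) *\<^sub>R v + (\<delta> * s (fst p)) *\<^sub>R f (perp e (snd p)))) \<in> borel_measurable borel"
        by (intro borel_measurable_continuous_onI continuous_on_compose2[OF g_cont])
           (auto intro!: continuous_intros continuous_on_compose2[OF s_cont[of UNIV]] continuous_on_compose2[OF fc])
      have [measurable]: "(\<lambda>p::(real ^ 'm) \<times> (real ^ 'n). snd p) \<in> borel \<rightarrow>\<^sub>M borel"
        by (auto intro!: borel_measurable_continuous_onI continuous_intros)
      have "(\<lambda>p. ennreal (g (fst p, (snd p \<bullet> e) *\<^sub>R v + (\<delta> * s (fst p)) *\<^sub>R f (perp e (snd p)))) *
              indicator {z. norm (perp e z) < 1} (snd p)) \<in> borel_measurable borel"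
        by measurable
      then have "(\<lambda>p. ennreal (g (fst p, (snd p \<bullet> e) *\<^sub>R v + (\<delta> * s (fst p)) *\<^sub>R f (perp e (snd p)))) *
              indicator {z. norm (perp e z) < 1} (snd p)) \<in> borel_measurable (lborel \<Otimes>\<^sub>M lborel)"
        unfolding lborel_prod by simp
      from lborel.borel_measurable_nn_integral_fst[OF this]
      show "(\<lambda>x. ennreal (s x ^ k) *
        (\<integral>\<^sup>+z. ennreal (g (x, (z \<bullet> e) *\<^sub>R v + (\<delta> * s x) *\<^sub>R f (perp e z))) *
              indicator {z. norm (perp e z) < 1} z \<partial>lborel)) \<in> borel_measurable lborel"
        by simp
    qed
    finally show ?thesis unfolding \<delta>_def .
  qed

  \<comment> \<open>Passage to the limit in the ratio\<close>
  define L where "L = unit_ball_vol (real k) * enn2real J"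
  \<comment> \<open>The limit of \<open>\<Phi>\<close> is one-sided, so the radius must approach 0
    through positive values.\<close>
  have "filterlim (\<lambda>u. sqrt (real k / u)) (at_right 0) at_top"
  proof -
    have "((\<lambda>u. sqrt (real k / u)) \<longlongrightarrow> sqrt 0) at_top"
      by (intro tendsto_real_sqrt tendsto_divide_0[OF tendsto_const] filterlim_at_top_imp_at_infinity filterlim_ident)
    moreover have "\<forall>\<^sub>F u in at_top. sqrt (real k / u) \<in> {0<..} \<and> sqrt (real k / u) \<noteq> 0"
      using eventually_gt_at_top[of 0] by eventually_elim (use k in simp)
    ultimately show ?thesis unfolding filterlim_at by (simp only: real_sqrt_zero simp_thms)
  qed
  from filterlim_compose[OF \<Phi> this]
  have "((\<lambda>u. \<Phi> (sqrt (real k / u))) \<longlongrightarrow> ennreal L) at_top"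
    using J_fin by (simp add: L_def ennreal_mult')
  then have \<Phi>_lim: "((\<lambda>u. enn2real (\<Phi> (sqrt (real k / u)))) \<longlongrightarrow> L) at_top"
    by (rule tendsto_enn2real) (simp add: L_def)
  define b where "b = real k / 2"
  \<comment> \<open>With \<open>b = k / 2\<close> the prefactor \<open>sqrt (k / u) ^ k\<close>
    equals \<open>(k / u) powr b\<close>, so multiplying by \<open>u powr b\<close> leaves
    \<open>k powr b\<close>.\<close>
  have P_lim: "((\<lambda>u. u powr b * P u) \<longlongrightarrow> real k powr b * L) at_top"
  proof (rule Lim_transform_eventually)
    show "((\<lambda>u. real k powr b * enn2real (\<Phi> (sqrt (real k / u)))) \<longlongrightarrow> real k powr b * L) at_top"
      by (intro tendsto_intros \<Phi>_lim)
    show "\<forall>\<^sub>F u in at_top. real k powr b * enn2real (\<Phi> (sqrt (real k / u))) = u powr b * P u"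
      using eventually_gt_at_top[of 0]
    proof eventually_elim
      case (elim u)
      have "P u = enn2real (ennreal (P u))" by (simp add: P_def)
      also have "\<dots> = sqrt (real k / u) ^ k * enn2real (\<Phi> (sqrt (real k / u)))"
        using elim by (subst P_eq) (simp_all add: enn2real_mult)
      also have "sqrt (real k / u) ^ k = (real k / u) powr b"
        using elim k by (simp add: b_def powr_half_sqrt[symmetric] powr_powr flip: powr_realpow)
      also have "\<dots> = real k powr b / u powr b" using elim by (simp add: powr_divide)
      finally show ?case using elim by simp
    qed
  qed
  define CF where "CF = (real m / real k) powr (- b) * (2 / real k) / Beta (real m / 2) b"
  have F_lim: "((\<lambda>u. u powr b * F_tail m k u) \<longlongrightarrow> CF) at_top"
    using F_tail_asymp[OF m k] unfolding CF_def b_def .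
  have B_pos: "Beta (real m / 2) b > 0"
    unfolding Beta_def b_def using m k by (intro divide_pos_pos mult_pos_pos Gamma_real_pos) auto
  then have CF_pos: "CF > 0" unfolding CF_def using m k by simp
  \<comment> \<open>The ball volume is \<open>pi powr b / (b * Gamma b)\<close>, and
    \<open>Beta\<close> in \<open>CF\<close> is a quotient of Gamma values. The factors
    \<open>b\<close>, \<open>Gamma b\<close> and \<open>k powr b\<close> cancel, leaving
    \<open>c\<close>.\<close>
  have const: "real k powr b * L / CF = enn2real (K_const g)"
  proof -
    have "b > 0" using k by (simp add: b_def)
    have G: "Gamma (real m / 2) > 0" "Gamma b > 0" "Gamma (real m / 2 + b) > 0"
      using m k by (auto simp: b_def intro!: Gamma_real_pos)
    have "Gamma (b + 1) = b * Gamma b" using \<open>b > 0\<close> by (intro Gamma_plus1) (auto elim!: nonpos_Ints_cases)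
    then have uv: "unit_ball_vol (real k) = pi powr b / (b * Gamma b)"
      unfolding unit_ball_vol_def b_def[symmetric] by simp
    have q: "(real m / real k) powr (- b) = real k powr b / real m powr b" "2 / real k = 1 / b"
      using m k by (simp_all add: powr_minus powr_divide b_def)
    have "real k powr b * unit_ball_vol (real k) / CF = c"
      unfolding uv CF_def c_def Beta_def add_divide_distrib b_def[symmetric] q
      using G \<open>b > 0\<close> m k by (simp add: powr_mult field_simps) (metis G(2) less_irrefl)
    then show ?thesis
      unfolding K L_def using c_pos by (simp add: enn2real_mult mult_ac) (metis mult.commute mult.left_commute times_divide_eq_left)
  qed
  \<comment> \<open>Numerator and denominator decay at the same rate; after multiplication by
    \<open>u powr b\<close> both converge, the denominator to the positive number
    \<open>CF\<close>.\<close>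
  have "((\<lambda>u. P u / F_tail m k u) \<longlongrightarrow> enn2real (K_const g)) at_top"
    unfolding const[symmetric]
  proof (rule Lim_transform_eventually)
    show "((\<lambda>u. (u powr b * P u) / (u powr b * F_tail m k u)) \<longlongrightarrow> real k powr b * L / CF) at_top"
      using CF_pos by (intro tendsto_divide P_lim F_lim) auto
    show "\<forall>\<^sub>F u in at_top. (u powr b * P u) / (u powr b * F_tail m k u) = P u / F_tail m k u"
      using eventually_gt_at_top[of 0] by eventually_elim simp
  qed
  then have "((\<lambda>u. P u / F_tail m k u - enn2real (K_const g)) \<longlongrightarrow> 0) at_top"
    by (simp add: LIM_zero)
  then have "(\<lambda>u. P u / F_tail m k u - enn2real (K_const g)) \<in> o[at_top](\<lambda>_. 1)"
    by (intro smalloI_tendsto) simp_all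
  then show ?thesis using K_pos K_fin unfolding P_def m_def k_def by simp
qed

end
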